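(* Let $\Delta\geq 1$ be an integer. If $G$ is a connected graph of maximum degree at most $\Delta$, then $\chi_{ur}'(G)\leq \Delta^2$, with equality if and only if $G$ is (isomorphic to) the complete bipartite graph $K_{\Delta,\Delta}$.
   Context: All graphs are finite, simple, and undirected. A matching in a graph $G$ is a set of pairwise non-adjacent edges of $G$; for a matching $M$, $V(M)$ denotes the set of vertices incident with an edge in $M$. A matching $M$ in $G$ is uniquely restricted if there is no matching $M'$ in $G$ with $M'\neq M$ and $V(M')=V(M)$. The uniquely restricted chromatic index $\chi'_{ur}(G)$ is the minimum number of uniquely restricted matchings in $G$ into which the edge set $E(G)$ can be partitioned. *)

theory Defs
  imports "Graph_Theory.Graph_Theory" "HOL-Library.Disjoint_Sets"
begin

text \<open>
  Finite simple undirected graphs are represented, as in the Graph-Theory library, by finite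
  symmetric loop-free digraphs (locale \<^locale>\<open>pair_graph\<close>): an undirected edge between
  \<open>u\<close> and \<open>v\<close> is the pair of arcs \<open>(u, v)\<close>, \<open>(v, u)\<close>. Since matchings and partitions of the edge
  set are about undirected edges, the two arcs are identified into the two-element set \<open>{u, v}\<close>.
\<close>

definition uedges :: "'a pair_pre_digraph \<Rightarrow> 'a set set" where
  "uedges G = {{u, v} | u v. (u, v) \<in> parcs G}"

text \<open>
  In a symmetric digraph, the out-degree is the number of neighbours, i.e. the degree in the
  undirected graph. The maximum is only meaningful for graphs with at least one vertex;
  \<^const>\<open>Digraph_Component.connected\<close> entails this.
\<close>

definition max_degree :: "'a pair_pre_digraph \<Rightarrow> nat" where
  "max_degree G = Max (out_degree (with_proj G) ` pverts G)"

definition is_matching :: "'a pair_pre_digraph \<Rightarrow> 'a set set \<Rightarrow> bool" where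
  "is_matching G M \<longleftrightarrow> M \<subseteq> uedges G \<and> pairwise disjnt M"

text \<open>Edges being vertex sets, \<open>\<Union>M\<close> is the set \<open>V(M)\<close> of vertices covered by \<open>M\<close>.\<close>

definition uniquely_restricted :: "'a pair_pre_digraph \<Rightarrow> 'a set set \<Rightarrow> bool" where
  "uniquely_restricted G M \<longleftrightarrow>
     is_matching G M \<and> \<not> (\<exists>M'. is_matching G M' \<and> M' \<noteq> M \<and> \<Union>M' = \<Union>M)"

definition ur_partition :: "'a pair_pre_digraph \<Rightarrow> 'a set set set \<Rightarrow> bool" where
  "ur_partition G P \<longleftrightarrow>
     finite P \<and> partition_on (uedges G) P \<and> (\<forall>M\<in>P. uniquely_restricted G M)"

definition ur_chromatic_index :: "'a pair_pre_digraph \<Rightarrow> nat" where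
  "ur_chromatic_index G = (LEAST k. \<exists>P. ur_partition G P \<and> card P = k)"

text \<open>
  The minimum is attained: the partition into single edges is always admissible.
\<close>

lemma uniquely_restricted_single:
  assumes "pair_graph G" and "e \<in> uedges G"
  shows "uniquely_restricted G {e}"
proof -
  interpret pair_graph G by fact
  have two: "card f = 2" if "f \<in> uedges G" for f
    using that no_loops by (fastforce simp: uedges_def card_insert_if)
  have "M' = {e}" if M': "is_matching G M'" "\<Union>M' = e" for M'
  proof -
    have "f = e" if "f \<in> M'" for f
    proof (rule card_subset_eq)
      show "finite e" using two[OF assms(2)] by (metis card.infinite zero_neq_numeral)
      show "f \<subseteq> e" using that M'(2) by blast
      show "card f = card e" using two assms(2) that M'(1) by (metis is_matching_def subsetD)
    qed
    moreover have "M' \<noteq> {}" using M'(2) two[OF assms(2)] by auto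
    ultimately show ?thesis by blast
  qed
  then show ?thesis
    using assms(2) by (auto simp: uniquely_restricted_def is_matching_def)
qed

lemma ur_partition_exists:
  assumes "pair_graph G"
  shows "\<exists>P. ur_partition G P"
proof -
  interpret pair_graph G by fact
  have "uedges G = (\<lambda>(u, v). {u, v}) ` parcs G" by (auto simp: uedges_def)
  then have "finite (uedges G)" by simp
  then have "ur_partition G ((\<lambda>e. {e}) ` uedges G)"
    using uniquely_restricted_single[OF assms]
    by (auto simp: ur_partition_def partition_on_def disjoint_def)
  then show ?thesis ..
qed

end

theory Submission
  imports Defs
begin

text \<open>
  Write \<open>N(w)\<close> for the neighbourhood of \<open>w\<close>. If \<open>M\<close> is a uniquely restricted matching, \<open>e = {w, u}\<close>
  is an edge, and no edge of \<open>M\<close> meets \<open>N(w)\<close>, then \<open>M\<close> together with \<open>e\<close> is again a uniquely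
  restricted matching: among the vertices to be covered, \<open>w\<close> has the single neighbour \<open>u\<close>, so \<open>e\<close>
  is forced (\<open>uniquely_restricted_insert\<close>). Hence a greedy edge colouring, which for each new edge
  chooses an endpoint \<open>w\<close> and avoids the colours of the edges that meet \<open>N(w)\<close>, has uniquely
  restricted colour classes. At most \<open>\<Delta>\<^sup>2\<close> edges meet \<open>N(w)\<close>, one of which is the new edge itself, so
  \<open>\<Delta>\<^sup>2\<close> colours suffice.

  One colour is saved as follows. A graph without edges needs no colour at all; otherwise let \<open>e\<close> be
  an edge, to be chosen suitably. By connectivity the edges can be coloured in
  an order that ends with \<open>e\<close> and in which every other edge is coloured while some edge that meets
  \<open>N(w)\<close>, for one of its endpoints \<open>w\<close>, is still uncoloured; so \<open>\<Delta>\<^sup>2 - 1\<close> colours are enough for all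
  edges but \<open>e\<close> (\<open>ur_colouring_towards_edge\<close>). For \<open>e\<close> itself they are also enough in each of
  these cases:
  \<^item> some vertex has degree less than \<open>\<Delta>\<close>, or there is a triangle: with \<open>e\<close> and \<open>w\<close> chosen
    there, fewer than \<open>\<Delta>\<^sup>2\<close> edges meet \<open>N(w)\<close> (\<open>ur_index_few_near\<close>);
  \<^item> there is an induced path \<open>x w u y\<close>: its two end edges form a uniquely restricted matching, they
    are given the same colour beforehand, and they both meet \<open>N(w)\<close> when the middle edge
    \<open>e = {w, u}\<close> is coloured last (\<open>ur_index_induced_P4\<close>).

  Otherwise \<open>G\<close> is \<open>\<Delta>\<close>-regular, triangle-free and has no induced path on four vertices. Then any
  two neighbours of a vertex have the same neighbourhood, and connectivity forces \<open>G\<close> to be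
  \<open>K\<^bsub>\<Delta>,\<Delta>\<^esub>\<close> (\<open>complete_bipartite_if_P4_closed\<close>).

  In \<open>K\<^bsub>\<Delta>,\<Delta>\<^esub>\<close>, conversely, the ends of two disjoint edges can be exchanged, so uniquely restricted
  matchings have at most one edge and all \<open>\<Delta>\<^sup>2\<close> edges need different colours
  (\<open>ur_index_complete_bipartite\<close>).
\<close>

section \<open>Colourings with uniquely restricted colour classes\<close>

definition nbrs :: "'a pair_pre_digraph \<Rightarrow> 'a \<Rightarrow> 'a set" where
  "nbrs G v = {u. (v, u) \<in> parcs G}"

text \<open>
  For an endpoint \<open>w\<close> of an edge \<open>e\<close>, these are the edges whose colours the greedy colouring avoids
  at \<open>e\<close>. They include all edges at \<open>w\<close>, and in particular \<open>e\<close>.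
\<close>

definition edges_near :: "'a pair_pre_digraph \<Rightarrow> 'a \<Rightarrow> 'a set set" where
  "edges_near G w = {f \<in> uedges G. f \<inter> nbrs G w \<noteq> {}}"

text \<open>Only the set \<open>S\<close> of edges is coloured so far; the values of \<open>c\<close> outside \<open>S\<close> are arbitrary.\<close>

definition ur_colouring :: "'a pair_pre_digraph \<Rightarrow> nat \<Rightarrow> 'a set set \<Rightarrow> ('a set \<Rightarrow> nat) \<Rightarrow> bool" where
  "ur_colouring G k S c \<longleftrightarrow> c ` S \<subseteq> {..<k} \<and> (\<forall>i. uniquely_restricted G {f \<in> S. c f = i})"

lemma ur_chromatic_index_le:
  assumes "finite (uedges G)" and "{} \<notin> uedges G" and "ur_colouring G k (uedges G) c"
  shows "ur_chromatic_index G \<le> k"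
proof -
  let ?cl = "\<lambda>i. {f \<in> uedges G. c f = i}"
  let ?P = "?cl ` c ` uedges G"
  have "ur_partition G ?P"
    using assms unfolding ur_partition_def partition_on_def disjoint_def ur_colouring_def by auto
  then have "ur_chromatic_index G \<le> card ?P"
    unfolding ur_chromatic_index_def by (intro Least_le) blast
  also have "\<dots> \<le> card (c ` uedges G)"
    using assms(1) by (intro card_image_le) simp
  also have "\<dots> \<le> card {..<k}"
    using assms(3) by (intro card_mono) (auto simp: ur_colouring_def)
  finally show ?thesis by simp
qed

context pair_graph
begin

section \<open>Edges meeting a neighbourhood\<close>

lemma nbrs_sym: "u \<in> nbrs G v \<longleftrightarrow> v \<in> nbrs G u"
  using sym_arcs by (auto simp: nbrs_def symmetric_conv)

lemma nbrs_irrefl: "v \<notin> nbrs G v"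
  using no_loops' by (auto simp: nbrs_def)

lemma finite_nbrs: "finite (nbrs G v)"
  by (rule finite_subset[OF _ pair_finite_verts]) (auto simp: nbrs_def dest: in_arcsD2)

lemma edge_iff: "{u, v} \<in> uedges G \<longleftrightarrow> v \<in> nbrs G u"
  using nbrs_sym by (auto simp: uedges_def nbrs_def doubleton_eq_iff)

lemma edge_iff_nbrs: "f \<in> uedges G \<longleftrightarrow> (\<exists>u v. f = {u, v} \<and> v \<in> nbrs G u)"
  by (auto simp: uedges_def nbrs_def)

lemma edge_other_end:
  assumes "f \<in> uedges G" "v \<in> f"
  obtains u where "f = {v, u}" "u \<in> nbrs G v" "v \<in> nbrs G u"
  using assms unfolding edge_iff_nbrs by (metis doubleton_eq_iff insertE nbrs_sym singletonD)

lemma finite_uedges: "finite (uedges G)"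
proof -
  have "uedges G = (\<lambda>(u, v). {u, v}) ` parcs G" by (auto simp: uedges_def)
  then show ?thesis by simp
qed

lemma edge_nonempty: "{} \<notin> uedges G"
  by (auto simp: uedges_def)

lemma edge_in_edges_near: "f \<in> uedges G \<Longrightarrow> w \<in> f \<Longrightarrow> f \<in> edges_near G w"
  by (auto simp: edges_near_def elim: edge_other_end)

lemma card_edges_at: "card {f \<in> uedges G. v \<in> f} = card (nbrs G v)"
proof -
  have "bij_betw (\<lambda>u. {v, u}) (nbrs G v) {f \<in> uedges G. v \<in> f}"
    by (auto simp: bij_betw_def inj_on_def doubleton_eq_iff edge_iff elim: edge_other_end)
  then show ?thesis by (metis bij_betw_same_card)
qed

lemma card_nbrs: "card (nbrs G v) = out_degree (with_proj G) v"
proof -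
  have "out_arcs (with_proj G) v = Pair v ` nbrs G v" by (auto simp: out_arcs_def nbrs_def)
  then show ?thesis by (simp add: out_degree_def card_image inj_on_def)
qed

lemma card_nbrs_le_max_degree: "card (nbrs G v) \<le> max_degree G"
proof (cases "v \<in> pverts G")
  case True
  then show ?thesis unfolding max_degree_def card_nbrs
    by (intro Max_ge) (auto simp: pair_finite_verts)
next
  case False
  then have "nbrs G v = {}" by (auto simp: nbrs_def dest: in_arcsD1)
  then show ?thesis by simp
qed

lemma edges_near_Un: "edges_near G w = (\<Union>v\<in>nbrs G w. {f \<in> uedges G. v \<in> f})"
  by (auto simp: edges_near_def)

lemma finite_edges_near: "finite (edges_near G w)"
  using finite_uedges by (simp add: edges_near_def)

lemma card_edges_near_le_sum: "card (edges_near G w) \<le> (\<Sum>v\<in>nbrs G w. card (nbrs G v))"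
  unfolding edges_near_Un card_edges_at[symmetric] by (rule card_UN_le) (rule finite_nbrs)

lemma card_edges_near:
  assumes "max_degree G \<le> \<Delta>"
  shows "card (edges_near G w) \<le> \<Delta>\<^sup>2"
proof -
  have "card (edges_near G w) \<le> (\<Sum>v\<in>nbrs G w. card (nbrs G v))"
    by (rule card_edges_near_le_sum)
  also have "\<dots> \<le> card (nbrs G w) * \<Delta>"
    using sum_bounded_above[of "nbrs G w" "\<lambda>v. card (nbrs G v)" \<Delta>]
      card_nbrs_le_max_degree assms le_trans by fastforce
  also have "\<dots> \<le> \<Delta> * \<Delta>"
    using card_nbrs_le_max_degree[of w] assms by (intro mult_right_mono) auto
  finally show ?thesis by (simp add: power2_eq_square)
qed

text \<open>The edges at a neighbour \<open>u\<close> of small degree contribute less than \<open>\<Delta>\<close>.\<close>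

lemma card_edges_near_low_degree:
  assumes "max_degree G \<le> \<Delta>" and "u \<in> nbrs G w" and "card (nbrs G u) < \<Delta>"
  shows "card (edges_near G w) < \<Delta>\<^sup>2"
proof -
  have "card (edges_near G w) \<le> (\<Sum>v\<in>nbrs G w. card (nbrs G v))"
    by (rule card_edges_near_le_sum)
  also have "\<dots> < (\<Sum>v\<in>nbrs G w. \<Delta>)"
    using card_nbrs_le_max_degree assms finite_nbrs le_trans by (intro sum_strict_mono_ex1) blast+
  also have "\<dots> \<le> \<Delta> * \<Delta>"
    using card_nbrs_le_max_degree[of w] assms by simp
  finally show ?thesis by (simp add: power2_eq_square)
qed

text \<open>
  The edge \<open>{u, v}\<close> of the triangle \<open>w u v\<close> is counted twice when the degrees of the neighbours of
  \<open>w\<close> are added up.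
\<close>

lemma card_edges_near_triangle:
  assumes "max_degree G \<le> \<Delta>" and "u \<in> nbrs G w" "v \<in> nbrs G w" "v \<in> nbrs G u"
  shows "card (edges_near G w) < \<Delta>\<^sup>2"
proof -
  let ?E = "\<lambda>x. {f \<in> uedges G. x \<in> f}"
  \<comment> \<open>Count \<open>{u, v}\<close> at \<open>u\<close> only.\<close>
  let ?g = "\<lambda>x. ?E x - (if x = v then {{u, v}} else {})"
  have uv: "u \<noteq> v" using assms(4) nbrs_irrefl by blast
  have E: "{u, v} \<in> uedges G" using assms(4) by (simp add: edge_iff)
  have "edges_near G w = (\<Union>x\<in>nbrs G w. ?g x)"
  proof
    have "f \<in> (\<Union>x\<in>nbrs G w. ?g x)" if "x \<in> nbrs G w" "f \<in> ?E x" for f x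
    proof (cases "x = v \<and> f = {u, v}")
      case True
      then have "f \<in> ?g u" using uv E by simp
      then show ?thesis using assms(2) by blast
    next
      case False
      then have "f \<in> ?g x" using that(2) by auto
      then show ?thesis using that(1) by blast
    qed
    then show "edges_near G w \<subseteq> (\<Union>x\<in>nbrs G w. ?g x)" unfolding edges_near_Un by blast
  qed (auto simp: edges_near_Un split: if_splits)
  then have "card (edges_near G w) \<le> (\<Sum>x\<in>nbrs G w. card (?g x))"
    using card_UN_le[OF finite_nbrs[of w], of ?g] by (simp only:)
  also have "\<dots> < (\<Sum>x\<in>nbrs G w. card (?E x))"
  proof (rule sum_strict_mono_ex1[OF finite_nbrs])
    show "\<forall>x\<in>nbrs G w. card (?g x) \<le> card (?E x)"
      using finite_uedges by (intro ballI card_mono) auto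
    have "card (?g v) < card (?E v)"
      using finite_uedges E by (intro psubset_card_mono) auto
    then show "\<exists>x\<in>nbrs G w. card (?g x) < card (?E x)" using assms(3) by blast
  qed
  also have "\<dots> \<le> card (nbrs G w) * \<Delta>"
    using sum_bounded_above[of "nbrs G w" "\<lambda>v. card (?E v)" \<Delta>]
      card_nbrs_le_max_degree assms(1) le_trans unfolding card_edges_at by fastforce
  also have "\<dots> \<le> \<Delta> * \<Delta>"
    using card_nbrs_le_max_degree[of w] assms by (intro mult_right_mono) auto
  finally show ?thesis by (simp add: power2_eq_square)
qed

section \<open>The greedy step\<close>

lemma uniquely_restricted_empty: "uniquely_restricted G {}"
  unfolding uniquely_restricted_def is_matching_def using edge_nonempty by fastforce

text \<open>
  No neighbour of \<open>w\<close> is covered by \<open>M\<close>, and neither is \<open>w\<close> itself, since its partner would be such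
  a neighbour. So \<open>w\<close> is a leaf of the subgraph induced by the covered vertices, and every matching
  that covers them contains \<open>e\<close>; removing \<open>e\<close> reduces uniqueness to that of \<open>M\<close>.
\<close>

lemma uniquely_restricted_insert:
  assumes M: "uniquely_restricted G M" and e: "e \<in> uedges G" "w \<in> e"
    and far: "M \<inter> edges_near G w = {}"
  shows "uniquely_restricted G (insert e M)"
proof -
  obtain u where u: "e = {w, u}" "u \<in> nbrs G w" "w \<in> nbrs G u"
    using e by (rule edge_other_end)
  have MM: "is_matching G M" using M by (simp add: uniquely_restricted_def)
  then have ME: "M \<subseteq> uedges G" by (simp add: is_matching_def)
  have away: "\<Union>M \<inter> nbrs G w = {}"
    using far ME by (fastforce simp: edges_near_def)
  have wM: "w \<notin> \<Union>M"
    using away ME by (auto elim!: edge_other_end)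
  have uM: "u \<notin> \<Union>M" using away u by blast
  have match: "is_matching G (insert e M)"
    using MM e(1) wM uM u(1) by (auto simp: is_matching_def pairwise_insert disjnt_def)
  have "M' = insert e M" if M': "is_matching G M'" "\<Union>M' = \<Union>(insert e M)" for M'
  proof -
    obtain f where f: "f \<in> M'" "w \<in> f" using M'(2) e(2) by blast
    then obtain z where z: "f = {w, z}" "z \<in> nbrs G w"
      using M'(1) by (meson edge_other_end is_matching_def subsetD)
    \<comment> \<open>The partner of \<open>w\<close> in \<open>M'\<close> is a covered neighbour of \<open>w\<close>, and \<open>u\<close> is the only one.\<close>
    have "z \<in> \<Union>(insert e M)" using z(1) f(1) M'(2) by blast
    then have "z = u" using z(2) away u(1) nbrs_irrefl by auto
    then have eM': "e \<in> M'" using f z u(1) by simp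
    have dis: "\<forall>g\<in>M' - {e}. g \<inter> e = {}"
      using M'(1) eM' by (auto simp: is_matching_def pairwise_def disjnt_def)
    have "\<Union>(M' - {e}) = \<Union>M"
    proof -
      have "\<Union>(M' - {e}) = \<Union>M' - e" using dis eM' by auto
      also have "\<dots> = \<Union>M" unfolding M'(2) using wM uM u(1) by auto
      finally show ?thesis .
    qed
    moreover have "is_matching G (M' - {e})"
      using M'(1) by (auto simp: is_matching_def pairwise_def)
    ultimately have "M' - {e} = M" using M unfolding uniquely_restricted_def by blast
    then show ?thesis using eM' by blast
  qed
  then show ?thesis using match unfolding uniquely_restricted_def by blast
qed

text \<open>
  A colour that does not occur on the edges near \<open>w\<close> extends its class by
  \<open>uniquely_restricted_insert\<close>.
\<close>

lemma ur_colouring_insert: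
  assumes c: "ur_colouring G k S c" and S: "S \<subseteq> uedges G" and e: "e \<in> uedges G" "e \<notin> S" "w \<in> e"
    and free: "card (c ` (S \<inter> edges_near G w)) < k"
  shows "\<exists>i. ur_colouring G k (insert e S) (c(e := i))"
proof -
  have "finite (c ` (S \<inter> edges_near G w))" using finite_edges_near by simp
  then have "\<not> {..<k} \<subseteq> c ` (S \<inter> edges_near G w)"
    using free by (metis card_lessThan card_mono leD)
  then obtain i where i: "i < k" "i \<notin> c ` (S \<inter> edges_near G w)" by blast
  have "uniquely_restricted G {f \<in> insert e S. (c(e := i)) f = j}" for j
  proof (cases "j = i")
    case True
    have "{f \<in> insert e S. (c(e := i)) f = j} = insert e {f \<in> S. c f = i}"
      using True e(2) by auto
    moreover have "uniquely_restricted G (insert e {f \<in> S. c f = i})"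
      using c i(2) e by (intro uniquely_restricted_insert) (auto simp: ur_colouring_def)
    ultimately show ?thesis by simp
  next
    case False
    then have "{f \<in> insert e S. (c(e := i)) f = j} = {f \<in> S. c f = j}"
      using e(2) by auto
    then show ?thesis using c by (simp add: ur_colouring_def)
  qed
  then have "ur_colouring G k (insert e S) (c(e := i))"
    using c i(1) by (auto simp: ur_colouring_def)
  then show ?thesis ..
qed

section \<open>Colouring towards a last edge\<close>

text \<open>
  If no edge outside \<open>U\<close> touched an edge of \<open>U\<close>, then the vertex set covered by \<open>U\<close> would be closed
  under adjacency, hence contain every vertex, including the ends of an edge outside \<open>U\<close>.
\<close>

lemma connected_edge_leaving:
  assumes conn: "Digraph_Component.connected (with_proj G)"
    and U: "U \<subseteq> uedges G" "U \<noteq> {}" "U \<noteq> uedges G"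
  shows "\<exists>g\<in>uedges G - U. \<exists>h\<in>U. g \<inter> h \<noteq> {}"
proof (rule ccontr)
  assume none: "\<not> ?thesis"
  obtain h where h: "h \<in> U" using U(2) by blast
  with U(1) obtain a where a: "h \<in> U" "a \<in> h" using edge_nonempty by (metis ex_in_conv subsetD)
  obtain g where g: "g \<in> uedges G - U" using U(1,3) by blast
  then obtain b where b: "g \<in> uedges G - U" "b \<in> g"
    using edge_nonempty by (metis DiffD1 ex_in_conv)
  have V: "x \<in> pverts G" if "f \<in> uedges G" "x \<in> f" for f x
    using that by (auto simp: uedges_def dest: in_arcsD1 in_arcsD2)
  have "a \<rightarrow>\<^sup>*\<^bsub>with_proj G\<^esub> b"
    using symmetric_connected_imp_strongly_connected[OF sym_arcs conn] V a b U(1)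
    by (auto simp: strongly_connected_def)
  then have "b \<in> \<Union>U"
  proof (induction rule: reachable_induct)
    case base
    then show ?case using a by blast
  next
    case (step x y)
    then have xy: "{x, y} \<in> uedges G" by (auto simp: uedges_def)
    obtain f where "f \<in> U" "x \<in> f" using step.IH by (rule UnionE)
    then have "{x, y} \<inter> f \<noteq> {}" by simp
    then have "{x, y} \<in> U" using none xy \<open>f \<in> U\<close> by (metis DiffI)
    then show ?case by (rule UnionI) simp
  qed
  then obtain f where "f \<in> U" "b \<in> f" by (rule UnionE)
  then show False using none b by (metis IntI emptyE)
qed

text \<open>
  Here \<open>S\<close> is a set of precoloured edges, all touching the last edge \<open>e\<close>, and \<open>U\<close> is the set of edges
  still uncoloured. The order of colouring is found backwards: \<open>U\<close> grows from \<open>{e}\<close> to the complement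
  of \<open>S\<close> by edges \<open>g\<close> that have an edge \<open>h \<in> U\<close> near one of their endpoints \<open>w\<close>. When \<open>g\<close> is coloured,
  both \<open>g\<close> and \<open>h\<close> are among the at most \<open>\<Delta>\<^sup>2\<close> edges near \<open>w\<close> and have no colour, so at most
  \<open>\<Delta>\<^sup>2 - 2\<close> colours are forbidden.
\<close>

lemma ur_colouring_towards_edge:
  assumes conn: "Digraph_Component.connected (with_proj G)" and D: "max_degree G \<le> \<Delta>"
    and e: "e \<in> uedges G" "e \<notin> S"
    and S: "S \<subseteq> uedges G" "\<forall>f\<in>S. f \<inter> e \<noteq> {}"
    and c: "ur_colouring G (\<Delta>\<^sup>2 - 1) S c"
    and U: "e \<in> U" "U \<subseteq> uedges G - S"
  shows "\<exists>c'. ur_colouring G (\<Delta>\<^sup>2 - 1) (uedges G - U) c' \<and> (\<forall>f\<in>S. c' f = c f)"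
  using U
proof (induction "card (uedges G - S - U)" arbitrary: U)
  case 0
  then have "uedges G - U = S" using finite_uedges S(1) by auto
  then show ?case using c by auto
next
  case (Suc n)
  have "uedges G - S - U \<noteq> {}" using Suc.hyps(2) by (metis Zero_not_Suc card.empty)
  then have "U \<union> S \<noteq> uedges G" by blast
  then obtain g h' where g: "g \<in> uedges G - (U \<union> S)" "h' \<in> U \<union> S" "g \<inter> h' \<noteq> {}"
    using connected_edge_leaving[OF conn, of "U \<union> S"] Suc.prems S(1) by blast
  obtain h w where h: "h \<in> U" "w \<in> g" "h \<in> edges_near G w"
  proof (cases "h' \<in> U")
    case True
    obtain x where x: "x \<in> g" "x \<in> h'" using g(3) by blast
    obtain z where "g = {x, z}" "x \<in> nbrs G z" using g(1) x(1) by (auto elim: edge_other_end)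
    then show ?thesis using that[of h' z] True x Suc.prems by (auto simp: edges_near_def)
  next
    case False
    \<comment> \<open>Now \<open>h'\<close> is precoloured. It touches both \<open>g\<close> and \<open>e\<close>, so \<open>e\<close> can take the role of \<open>h\<close>.\<close>
    then have h': "h' \<in> uedges G" "h' \<inter> e \<noteq> {}" using g(2) S by auto
    obtain x where x: "x \<in> g" "x \<in> h'" using g(3) by blast
    obtain y where y: "h' = {x, y}" "y \<in> nbrs G x" using h'(1) x(2) by (auto elim: edge_other_end)
    obtain z where z: "g = {x, z}" "x \<in> nbrs G z" using g(1) x(1) by (auto elim: edge_other_end)
    show ?thesis
    proof (cases "x \<in> e")
      case True
      then show ?thesis using that[of e z] z Suc.prems e by (auto simp: edges_near_def)
    next
      case False
      then have "y \<in> e" using h'(2) y(1) by auto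
      then show ?thesis using that[of e x] x(1) y(2) Suc.prems e by (auto simp: edges_near_def)
    qed
  qed
  have "uedges G - S - insert g U = (uedges G - S - U) - {g}" by auto
  then have "n = card (uedges G - S - insert g U)"
    using Suc.hyps(2) g(1) finite_uedges by (simp add: card_Diff_singleton)
  then obtain c' where c': "ur_colouring G (\<Delta>\<^sup>2 - 1) (uedges G - insert g U) c'" "\<forall>f\<in>S. c' f = c f"
    using Suc.hyps(1)[of "insert g U"] Suc.prems g(1) by auto
  have gw: "g \<in> edges_near G w" using g(1) h(2) by (simp add: edge_in_edges_near)
  have gh: "g \<noteq> h" using g(1) h(1) by blast
  have "card (c' ` ((uedges G - insert g U) \<inter> edges_near G w))
      \<le> card ((uedges G - insert g U) \<inter> edges_near G w)"
    using finite_edges_near by (intro card_image_le) simp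
  also have "\<dots> \<le> card (edges_near G w - {g, h})"
    using finite_edges_near h(1) by (intro card_mono) auto
  also have "\<dots> < \<Delta>\<^sup>2 - 1"
  proof -
    have "card {g, h} \<le> card (edges_near G w)"
      using finite_edges_near gw h(3) by (intro card_mono) auto
    then show ?thesis
      using card_edges_near[OF D, of w] gw h(3) gh by (simp add: card_Diff_subset)
  qed
  finally obtain i where "ur_colouring G (\<Delta>\<^sup>2 - 1) (insert g (uedges G - insert g U)) (c'(g := i))"
    using ur_colouring_insert[OF c'(1), of g w] g(1) h(2) by blast
  moreover have "insert g (uedges G - insert g U) = uedges G - U" using g(1) by auto
  moreover have "\<forall>f\<in>S. (c'(g := i)) f = c f" using c'(2) g(1) by auto
  ultimately show ?case by metis
qed

lemma ur_colouring_complete: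
  assumes conn: "Digraph_Component.connected (with_proj G)" and D: "max_degree G \<le> \<Delta>"
    and e: "e \<in> uedges G" "e \<notin> S" "w \<in> e"
    and S: "S \<subseteq> uedges G" "\<forall>f\<in>S. f \<inter> e \<noteq> {}"
    and c: "ur_colouring G (\<Delta>\<^sup>2 - 1) S c"
    and saving: "\<And>c'. \<forall>f\<in>S. c' f = c f \<Longrightarrow> card (c' ` (edges_near G w - {e})) < \<Delta>\<^sup>2 - 1"
  shows "ur_chromatic_index G \<le> \<Delta>\<^sup>2 - 1"
proof -
  obtain c' where c': "ur_colouring G (\<Delta>\<^sup>2 - 1) (uedges G - {e}) c'" "\<forall>f\<in>S. c' f = c f"
    using ur_colouring_towards_edge[OF conn D e(1,2) S c, of "{e}"] e(1,2) by auto
  have "(uedges G - {e}) \<inter> edges_near G w = edges_near G w - {e}" by (auto simp: edges_near_def)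
  then have free: "card (c' ` ((uedges G - {e}) \<inter> edges_near G w)) < \<Delta>\<^sup>2 - 1"
    using saving[OF c'(2)] by simp
  obtain i where i: "ur_colouring G (\<Delta>\<^sup>2 - 1) (insert e (uedges G - {e})) (c'(e := i))"
    using ur_colouring_insert[OF c'(1) Diff_subset e(1) _ e(3) free] by blast
  have "insert e (uedges G - {e}) = uedges G" using e(1) by blast
  then show ?thesis
    using ur_chromatic_index_le[OF finite_uedges edge_nonempty] i by simp
qed

section \<open>Configurations that save a colour\<close>

text \<open>When \<open>e\<close> is coloured last, the other edges near \<open>w\<close> are too few to block all \<open>\<Delta>\<^sup>2 - 1\<close> colours.\<close>

lemma ur_index_few_near:
  assumes conn: "Digraph_Component.connected (with_proj G)" and D: "max_degree G \<le> \<Delta>"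
    and e: "e \<in> uedges G" "w \<in> e" and few: "card (edges_near G w) < \<Delta>\<^sup>2"
  shows "ur_chromatic_index G \<le> \<Delta>\<^sup>2 - 1"
proof (rule ur_colouring_complete[OF conn D, where e = e and w = w and S = "{}" and c = "\<lambda>_. 0"])
  have ew: "e \<in> edges_near G w" using e by (rule edge_in_edges_near)
  fix c' :: "'a set \<Rightarrow> nat"
  have "card (c' ` (edges_near G w - {e})) \<le> card (edges_near G w - {e})"
    using finite_edges_near by (intro card_image_le) simp
  also have "\<dots> < card (edges_near G w)"
    using ew finite_edges_near by (intro psubset_card_mono) auto
  finally show "card (c' ` (edges_near G w - {e})) < \<Delta>\<^sup>2 - 1" using few by simp
qed (use e uniquely_restricted_empty in \<open>auto simp: ur_colouring_def\<close>)

text \<open>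
  The end edges \<open>{w, x}\<close> and \<open>{u, y}\<close> of the path \<open>x w u y\<close> form a uniquely restricted matching because
  \<open>x\<close> has no neighbour on the other one. Coloured alike, they account for one colour only among the
  edges near \<open>w\<close>, which is the saving required at the middle edge.
\<close>

lemma ur_index_induced_P4:
  assumes conn: "Digraph_Component.connected (with_proj G)" and D: "max_degree G \<le> \<Delta>"
    and path: "x \<in> nbrs G w" "u \<in> nbrs G w" "y \<in> nbrs G u" and dist: "x \<noteq> u" "y \<noteq> w" "x \<noteq> y"
    and chords: "x \<notin> nbrs G u" "y \<notin> nbrs G w" "y \<notin> nbrs G x"
  shows "ur_chromatic_index G \<le> \<Delta>\<^sup>2 - 1"
proof -
  let ?e = "{w, u}" and ?f = "{w, x}" and ?f' = "{u, y}"
  have E: "?e \<in> uedges G" "?f \<in> uedges G" "?f' \<in> uedges G" using path by (simp_all add: edge_iff)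
  have wu: "w \<noteq> u" using path(2) nbrs_irrefl by blast
  have ne: "?e \<noteq> ?f" "?e \<noteq> ?f'" "?f \<noteq> ?f'" using dist wu by (auto simp: doubleton_eq_iff)
  \<comment> \<open>There must be a colour to give to the end edges.\<close>
  have D2: "\<Delta> \<ge> 2"
  proof -
    have "card {x, u} \<le> card (nbrs G w)" using path finite_nbrs by (intro card_mono) auto
    then show ?thesis using dist(1) card_nbrs_le_max_degree[of w] D by simp
  qed
  then have "2 * 2 \<le> \<Delta> * \<Delta>" by (intro mult_mono) auto
  then have D4: "\<Delta>\<^sup>2 \<ge> 4" by (simp add: power2_eq_square)
  have near: "?e \<in> edges_near G w" "?f \<in> edges_near G w" "?f' \<in> edges_near G w"
    using E path(1,2) by (simp_all add: edges_near_def)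
  have "uniquely_restricted G (insert ?f {?f'})"
  proof (rule uniquely_restricted_insert[where w = x])
    show "uniquely_restricted G {?f'}"
      using uniquely_restricted_single[OF _ E(3)] by blast
    show "{?f'} \<inter> edges_near G x = {}"
      using chords nbrs_sym by (auto simp: edges_near_def)
  qed (use E in auto)
  moreover have "{f \<in> {?f, ?f'}. (0::nat) = i} = (if i = 0 then {?f, ?f'} else {})" for i
    by auto
  ultimately have ur: "uniquely_restricted G {f \<in> {?f, ?f'}. (0::nat) = i}" for i
    using uniquely_restricted_empty by presburger
  show ?thesis
  proof (rule ur_colouring_complete[OF conn D, where e = ?e and w = w
        and S = "{?f, ?f'}" and c = "\<lambda>_. 0"])
    show "ur_colouring G (\<Delta>\<^sup>2 - 1) {?f, ?f'} (\<lambda>_. 0)"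
      using ur D4 by (auto simp: ur_colouring_def)
    fix c' :: "'a set \<Rightarrow> nat"
    assume "\<forall>f\<in>{?f, ?f'}. c' f = 0"
    then have "c' ?f' = c' ?f" by simp
    moreover have "?f \<in> edges_near G w - {?e, ?f'}" using near ne by blast
    ultimately have "c' ?f' \<in> c' ` (edges_near G w - {?e, ?f'})" by (metis imageI)
    moreover have "edges_near G w - {?e} = insert ?f' (edges_near G w - {?e, ?f'})"
      using near ne by blast
    ultimately have "c' ` (edges_near G w - {?e}) = c' ` (edges_near G w - {?e, ?f'})"
      by (simp add: insert_absorb)
    then have "card (c' ` (edges_near G w - {?e})) \<le> card (edges_near G w - {?e, ?f'})"
      using finite_edges_near by (simp add: card_image_le)
    also have "\<dots> < \<Delta>\<^sup>2 - 1"
      using near ne D4 card_edges_near[OF D, of w] by (simp add: card_Diff_subset)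
    finally show "card (c' ` (edges_near G w - {?e})) < \<Delta>\<^sup>2 - 1" .
  qed (use E ne in auto)
qed

section \<open>The extremal graph\<close>

text \<open>
  The hypothesis \<open>closed\<close>, applied in both directions, says that two neighbours of a vertex have the
  same neighbourhood. So for an edge \<open>{w, u}\<close> every vertex in \<open>N(w)\<close> has the neighbourhood \<open>N(u)\<close> and
  vice versa; these two sets are disjoint, since a common vertex would make them equal and \<open>u\<close> its
  own neighbour, and they exhaust the connected graph.
\<close>

lemma complete_bipartite_if_P4_closed:
  assumes conn: "Digraph_Component.connected (with_proj G)"
    and reg: "\<And>v. v \<in> pverts G \<Longrightarrow> card (nbrs G v) = \<Delta>" and e: "u \<in> nbrs G w"
    and closed: "\<And>x w u y. x \<in> nbrs G w \<Longrightarrow> u \<in> nbrs G w \<Longrightarrow> y \<in> nbrs G u \<Longrightarrow> y \<in> nbrs G x"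
  shows "complete_bipartite_digraph \<Delta> \<Delta> (with_proj G)"
proof -
  let ?A = "nbrs G w" and ?B = "nbrs G u"
  have w: "w \<in> ?B" using e nbrs_sym by blast
  have A: "nbrs G a = ?B" if "a \<in> ?A" for a using closed that e by blast
  have B: "nbrs G b = ?A" if "b \<in> ?B" for b using closed that w by blast
  have V: "w \<in> pverts G" "u \<in> pverts G" "?A \<subseteq> pverts G" "?B \<subseteq> pverts G"
    using e by (auto simp: nbrs_def dest: in_arcsD1 in_arcsD2)
  have disj: "?A \<inter> ?B = {}" using A B e nbrs_irrefl by blast
  have cover: "v \<in> ?A \<union> ?B" if "v \<in> pverts G" for v
  proof -
    have "w \<rightarrow>\<^sup>*\<^bsub>with_proj G\<^esub> v"
      using symmetric_connected_imp_strongly_connected[OF sym_arcs conn] V that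
      by (auto simp: strongly_connected_def)
    then show ?thesis
    proof (induction rule: reachable_induct)
      case base
      then show ?case using w by blast
    next
      case (step x y)
      then have "y \<in> nbrs G x" by (auto simp: nbrs_def)
      then show ?case using step A B by blast
    qed
  qed
  have "parcs G = ?A \<times> ?B \<union> ?B \<times> ?A"
  proof -
    have "(x, y) \<in> parcs G \<longleftrightarrow> x \<in> ?A \<and> y \<in> ?B \<or> x \<in> ?B \<and> y \<in> ?A" for x y
    proof -
      have "(x, y) \<in> parcs G \<longleftrightarrow> y \<in> nbrs G x" by (simp add: nbrs_def)
      moreover have "x \<in> ?A \<union> ?B" if "(x, y) \<in> parcs G" using cover that by (blast dest: in_arcsD1)
      ultimately show ?thesis using A B by blast
    qed
    then show ?thesis by auto
  qed
  moreover have "pverts G = ?A \<union> ?B" using cover V by blast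
  ultimately show ?thesis
    unfolding complete_bipartite_digraph_pair_def
    using disj reg[OF V(1)] reg[OF V(2)] pair_finite_verts by metis
qed

text \<open>
  An edge at a vertex of degree less than \<open>\<Delta>\<close>, an edge of a triangle, or the middle edge of an
  induced path on four vertices would save a colour. If the graph has edges but none of these kinds,
  it is \<open>\<Delta>\<close>-regular and a path \<open>x w u y\<close> can only have the chord \<open>{x, y}\<close>, which is the closure property that characterises
  the complete bipartite graph.
\<close>

lemma ur_index_less_or_complete_bipartite:
  assumes "\<Delta> \<ge> 1" and conn: "Digraph_Component.connected (with_proj G)"
    and D: "max_degree G \<le> \<Delta>"
  shows "ur_chromatic_index G < \<Delta>\<^sup>2 \<or> complete_bipartite_digraph \<Delta> \<Delta> (with_proj G)"
proof (rule disjCI)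
  assume nK: "\<not> complete_bipartite_digraph \<Delta> \<Delta> (with_proj G)"
  have "ur_chromatic_index G \<le> \<Delta>\<^sup>2 - 1"
  proof (cases "uedges G = {}")
    case True
    then have "ur_colouring G 0 (uedges G) (\<lambda>_. 0)"
      using uniquely_restricted_empty by (simp add: ur_colouring_def)
    then show ?thesis using ur_chromatic_index_le[OF finite_uedges edge_nonempty] by fastforce
  next
    case False
    then obtain u w where uw: "u \<in> nbrs G w" by (auto simp: edge_iff_nbrs)
    then have w: "{w, u} \<in> uedges G" by (simp add: edge_iff)
    show ?thesis
    proof (rule ccontr)
      assume big: "\<not> ?thesis"
      have reg: "card (nbrs G v) = \<Delta>" if "v \<in> pverts G" for v
      proof (rule ccontr)
        assume "card (nbrs G v) \<noteq> \<Delta>"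
        then have low: "card (nbrs G v) < \<Delta>" using card_nbrs_le_max_degree[of v] D by simp
        \<comment> \<open>An isolated vertex would be the whole graph, but \<open>{w, u}\<close> is an edge.\<close>
        have "nbrs G v \<noteq> {}"
        proof
          assume "nbrs G v = {}"
          have "w \<in> pverts G" using uw by (auto simp: nbrs_def dest: in_arcsD1)
          then have "v \<rightarrow>\<^sup>*\<^bsub>with_proj G\<^esub> w"
            using symmetric_connected_imp_strongly_connected[OF sym_arcs conn] that
            by (auto simp: strongly_connected_def)
          then show False using \<open>nbrs G v = {}\<close> uw
            by (cases rule: converse_reachable_cases) (auto simp: nbrs_def)
        qed
        then obtain a where a: "a \<in> nbrs G v" by blast
        then have "card (edges_near G a) < \<Delta>\<^sup>2"
          using card_edges_near_low_degree[OF D _ low] nbrs_sym by blast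
        moreover have "{v, a} \<in> uedges G" using a by (simp add: edge_iff)
        ultimately show False using ur_index_few_near[OF conn D] big by blast
      qed
      have tri: "v \<notin> nbrs G u" if "u \<in> nbrs G w" "v \<in> nbrs G w" for u v w
      proof
        assume "v \<in> nbrs G u"
        then have "card (edges_near G w) < \<Delta>\<^sup>2" using card_edges_near_triangle[OF D that] by simp
        moreover have "{w, u} \<in> uedges G" using that by (simp add: edge_iff)
        ultimately show False using ur_index_few_near[OF conn D] big by blast
      qed
      have "y \<in> nbrs G x" if p: "x \<in> nbrs G w" "u \<in> nbrs G w" "y \<in> nbrs G u" for x w u y
      proof (cases "x = u \<or> y = w")
        case True
        then show ?thesis using p nbrs_sym by blast
      next
        case False
        have "x \<notin> nbrs G u" "y \<notin> nbrs G w" using tri p nbrs_sym by blast+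
        moreover from this p have "x \<noteq> y" by blast
        ultimately show ?thesis using ur_index_induced_P4[OF conn D p] big False by blast
      qed
      then show False
        using nK complete_bipartite_if_P4_closed[OF conn reg uw] by blast
    qed
  qed
  moreover have "\<Delta>\<^sup>2 > 0" using assms(1) by simp
  ultimately show "ur_chromatic_index G < \<Delta>\<^sup>2" by linarith
qed

lemma ur_index_all_singletons:
  assumes single: "\<And>M e f. uniquely_restricted G M \<Longrightarrow> e \<in> M \<Longrightarrow> f \<in> M \<Longrightarrow> e = f"
  shows "ur_chromatic_index G = card (uedges G)"
proof -
  have all: "card P = card (uedges G)" if P: "ur_partition G P" for P
  proof -
    have part: "\<Union>P = uedges G" "{} \<notin> P" and ur: "\<forall>M\<in>P. uniquely_restricted G M"
      using P by (auto simp: ur_partition_def partition_on_def)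
    have "P = (\<lambda>e. {e}) ` uedges G"
    proof (intro equalityI subsetI)
      fix M assume M: "M \<in> P"
      then obtain e where "e \<in> M" using part(2) by (metis equals0I)
      moreover from this have "M = {e}" using single[OF bspec[OF ur M]] by blast
      ultimately show "M \<in> (\<lambda>e. {e}) ` uedges G" using M part(1) by blast
    next
      fix M assume "M \<in> (\<lambda>e. {e}) ` uedges G"
      then obtain e N where N: "M = {e}" "e \<in> N" "N \<in> P" using part(1) by blast
      then have "N = {e}" using single[OF bspec[OF ur N(3)]] by blast
      then show "M \<in> P" using N by simp
    qed
    then show ?thesis by (simp add: card_image)
  qed
  have "pair_graph G" by unfold_locales
  then obtain P where "ur_partition G P" using ur_partition_exists by blast
  with all show ?thesis
    unfolding ur_chromatic_index_def by (intro Least_equality) auto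
qed

end

text \<open>
  Two edges \<open>{a, b}\<close> and \<open>{a', b'}\<close> of a matching, with \<open>a\<close> and \<open>a'\<close> on the same side, can be
  replaced by \<open>{a, b'}\<close> and \<open>{a', b}\<close>; hence uniquely restricted matchings have at most one edge.
\<close>

lemma ur_index_complete_bipartite:
  assumes K: "complete_bipartite_digraph m n (with_proj G)"
  shows "ur_chromatic_index G = m * n"
proof -
  interpret pair_graph G using K by (rule pair_graphI_complete_bipartite)
  obtain A B where AB: "A \<inter> B = {}" "card A = m" "card B = n" "parcs G = A \<times> B \<union> B \<times> A"
    using K unfolding complete_bipartite_digraph_pair_def by blast
  have E: "f \<in> uedges G \<longleftrightarrow> (\<exists>a\<in>A. \<exists>b\<in>B. f = {a, b})" for f
    unfolding uedges_def AB(4) by (auto simp: insert_commute)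
  have "e = f" if M: "uniquely_restricted G M" and e: "e \<in> M" and f: "f \<in> M" for M e f
  proof (rule ccontr)
    assume ne: "e \<noteq> f"
    have match: "is_matching G M" using M by (simp add: uniquely_restricted_def)
    then have sub: "M \<subseteq> uedges G" by (simp add: is_matching_def)
    obtain a b where ab: "e = {a, b}" "a \<in> A" "b \<in> B" using E[of e] e sub by blast
    obtain a' b' where ab': "f = {a', b'}" "a' \<in> A" "b' \<in> B" using E[of f] f sub by blast
    have dis: "g \<inter> h = {}" if "g \<in> M" "h \<in> M" "g \<noteq> h" for g h
      using match that by (auto simp: is_matching_def pairwise_def disjnt_def)
    have d: "a \<noteq> a'" "b \<noteq> b'" "a \<noteq> b'" "a' \<noteq> b" "a \<noteq> b" "a' \<noteq> b'"
      using dis[OF e f ne] ab ab' AB(1) by auto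
    let ?R = "M - {e, f}"
    let ?M' = "insert {a, b'} (insert {a', b} ?R)"
    have R: "g \<inter> {a, b, a', b'} = {}" if "g \<in> ?R" for g
      using dis[of g e] dis[of g f] that e f ab(1) ab'(1) by auto
    have "is_matching G ?M'"
      unfolding is_matching_def
    proof
      show "?M' \<subseteq> uedges G" using sub ab(2,3) ab'(2,3) E[of "{a, b'}"] E[of "{a', b}"] by blast
      have "pairwise disjnt ?R" using match by (auto simp: is_matching_def pairwise_def)
      then show "pairwise disjnt ?M'"
        using R d by (auto simp: pairwise_insert disjnt_def)
    qed
    moreover have "\<Union>?M' = \<Union>M"
    proof -
      have "M = insert e (insert f ?R)" using e f by blast
      then have "\<Union>M = e \<union> f \<union> \<Union>?R" by blast
      then show ?thesis using ab(1) ab'(1) by auto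
    qed
    moreover have "?M' \<noteq> M"
    proof
      assume "?M' = M"
      then have "{a, b'} \<in> M" by blast
      then show False using dis[of "{a, b'}" e] e ab(1) d by (auto simp: doubleton_eq_iff)
    qed
    ultimately show False using M unfolding uniquely_restricted_def by blast
  qed
  then have "ur_chromatic_index G = card (uedges G)" by (rule ur_index_all_singletons)
  also have "uedges G = (\<lambda>(a, b). {a, b}) ` (A \<times> B)" using E by auto
  also have "card \<dots> = card (A \<times> B)"
    using AB(1) by (intro card_image) (auto simp: inj_on_def doubleton_eq_iff)
  finally show ?thesis using AB by (simp add: card_cartesian_product)
qed

theorem theorem3:
  fixes G :: "'a pair_pre_digraph" and \<Delta> :: nat
  assumes "\<Delta> \<ge> 1"
    and "pair_graph G"
    and "Digraph_Component.connected (with_proj G)"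
    and "max_degree G \<le> \<Delta>"
  shows "ur_chromatic_index G \<le> \<Delta>\<^sup>2 \<and>
    (ur_chromatic_index G = \<Delta>\<^sup>2 \<longleftrightarrow> complete_bipartite_digraph \<Delta> \<Delta> (with_proj G))"
proof -
  interpret pair_graph G by fact
  have "ur_chromatic_index G = \<Delta>\<^sup>2" if "complete_bipartite_digraph \<Delta> \<Delta> (with_proj G)"
    using ur_index_complete_bipartite[OF that] by (simp add: power2_eq_square)
  then show ?thesis
    using ur_index_less_or_complete_bipartite[OF assms(1,3,4)] by auto
qed

end
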